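(* Let $K$ be a polygonal knot in $\mathbb{R}^3$ in general position, with exactly $n$ edges. Then $K$ has at most $U_n=\dfrac{n}{12}(n-3)(n-4)(n-5)$ generic quadrisecants.
   Context: A polygonal knot in $\mathbb{R}^3$ is a simple closed curve made of finitely many ($n\ge 3$) straight line segments (its edges), whose endpoints are its vertices. Two segments are called skew if the lines they span are skew (do not lie in a common plane). Three pairwise skew lines in $\mathbb{R}^3$ determine a unique quadric surface containing them (a hyperbolic paraboloid or a hyperboloid of one sheet); the quadric generated by three pairwise skew edges is the one determined by the lines they span. A polygonal knot $K$ is in general position if: (i) no four vertices of $K$ are coplanar; and (ii) given three edges $e_1,e_2,e_3$ of $K$ that are pairwise skew, no other edge of $K$ is contained in the quadric generated by $e_1,e_2,e_3$. Let $K$ be a polygonal knot in general position with vertex set $V$. A generic quadrisecant of $K$ is an unoriented line in $\mathbb{R}^3$ that is disjoint from $V$ and intersects $K$ in exactly four distinct points. *)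

theory Defs
  imports "HOL-Analysis.Analysis"
begin

(* The last two equations only make the function total. *)
fun polygonal_path :: "(real^3) list \<Rightarrow> real \<Rightarrow> real^3" where
  "polygonal_path (a # b # c # vs) = linepath a b +++ polygonal_path (b # c # vs)"
| "polygonal_path [a, b] = linepath a b"
| "polygonal_path [a] = linepath a a"
| "polygonal_path [] = linepath 0 0"

definition closed_polygon :: "(real^3) list \<Rightarrow> real \<Rightarrow> real^3" where
  "closed_polygon vs = polygonal_path (vs @ [hd vs])"

(* A polygonal knot is given by its vertices in cyclic order. Simplicity of the curve
   entails that the vertices are pairwise distinct. *)
definition polygonal_knot :: "(real^3) list \<Rightarrow> bool" where
  "polygonal_knot vs \<longleftrightarrow> length vs \<ge> 3 \<and> simple_path (closed_polygon vs)"

definition edges :: "(real^3) list \<Rightarrow> (real^3) set set" where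
  "edges vs = {closed_segment (vs ! i) (vs ! (Suc i mod length vs)) | i. i < length vs}"

definition skew :: "(real^3) set \<Rightarrow> (real^3) set \<Rightarrow> bool" where
  "skew e f \<longleftrightarrow> \<not> coplanar (affine hull e \<union> affine hull f)"

(* Zero sets of polynomials of degree exactly 2: the symmetric matrix A represents the
   quadratic part, which therefore vanishes only if A does. *)
definition quadric :: "(real^3) set \<Rightarrow> bool" where
  "quadric Q \<longleftrightarrow> (\<exists>(A::real^3^3) b c. transpose A = A \<and> A \<noteq> 0 \<and>
     Q = {x. x \<bullet> (A *v x) + b \<bullet> x + c = 0})"

(* Meaningful for pairwise skew segments, whose three lines lie on exactly one quadric. *)
definition generated_quadric ::
    "(real^3) set \<Rightarrow> (real^3) set \<Rightarrow> (real^3) set \<Rightarrow> (real^3) set" where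
  "generated_quadric e1 e2 e3 =
     (THE Q. quadric Q \<and> affine hull e1 \<subseteq> Q \<and> affine hull e2 \<subseteq> Q \<and> affine hull e3 \<subseteq> Q)"

definition general_position :: "(real^3) list \<Rightarrow> bool" where
  "general_position vs \<longleftrightarrow>
     (\<forall>W \<subseteq> set vs. card W = 4 \<longrightarrow> \<not> coplanar W) \<and>
     (\<forall>e1 \<in> edges vs. \<forall>e2 \<in> edges vs. \<forall>e3 \<in> edges vs.
        skew e1 e2 \<and> skew e1 e3 \<and> skew e2 e3 \<longrightarrow>
        (\<forall>e \<in> edges vs - {e1, e2, e3}. \<not> e \<subseteq> generated_quadric e1 e2 e3))"

definition generic_quadrisecant :: "(real^3) list \<Rightarrow> (real^3) set \<Rightarrow> bool" where
  "generic_quadrisecant vs L \<longleftrightarrow>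
     affine L \<and> aff_dim L = 1 \<and> L \<inter> set vs = {} \<and>
     card (L \<inter> path_image (closed_polygon vs)) = 4"

lemma pathstart_polygonal_path: "vs \<noteq> [] \<Longrightarrow> pathstart (polygonal_path vs) = hd vs"
  by (induction vs rule: polygonal_path.induct) auto

lemma path_image_polygonal_path:
  "length vs \<ge> 2 \<Longrightarrow>
   path_image (polygonal_path vs) = (\<Union>i<length vs - 1. closed_segment (vs ! i) (vs ! Suc i))"
proof (induction vs rule: polygonal_path.induct)
  case (1 a b c vs)
  have "{..<length (a # b # c # vs) - 1} = insert 0 (Suc ` {..<length (b # c # vs) - 1})"
    by (simp add: lessThan_Suc_eq_insert_0)
  with 1 show ?case
    by (simp add: path_image_join pathstart_polygonal_path del: lessThan_Suc)
qed (auto simp: lessThan_Suc)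

lemma path_image_closed_polygon:
  assumes "vs \<noteq> []"
  shows "path_image (closed_polygon vs) = \<Union> (edges vs)"
proof -
  have "(vs @ [hd vs]) ! Suc i = vs ! (Suc i mod length vs)" if "i < length vs" for i
    using that assms by (cases "Suc i = length vs") (auto simp: nth_append hd_conv_nth)
  then have "path_image (closed_polygon vs) =
      (\<Union>i<length vs. closed_segment (vs ! i) (vs ! (Suc i mod length vs)))"
    using assms
    by (simp add: closed_polygon_def path_image_polygonal_path Suc_le_eq nth_append del: nth_append_length)
  then show ?thesis
    by (auto simp: edges_def)
qed

end

theory Submission
  imports Defs
begin

text \<open>A generic quadrisecant meets four distinct edges. If three of them are consecutive, the
  quadrisecant is the line of the middle one and contains vertices. If two are adjacent, it lies in
  the plane of their three vertices, which each of the other two edges meets at most once, so it is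
  unique. If no two are adjacent, the edges are pairwise skew: three quadrisecants through them would
  lie on the quadric generated by three of the edges, and the fourth edge, meeting the quadric in three
  points, would be contained in it. Hence there are at most two.

  So the number of quadrisecants through four edges is at most the number of pairs of opposite
  gaps, in the cyclic order, in which neither gap is an adjacency. Summed over all
  quadruples of edges this gives exactly the bound.\<close>

section \<open>Lines, planes and segments in three-dimensional space\<close>

text \<open>An affine basis of \<open>S\<close> is not coplanar either, so it has at least four
  points and dimension 3.\<close>

lemma affine_hull_eq_UNIV_if_not_coplanar:
  fixes S :: "(real^3) set"
  assumes "\<not> coplanar S"
  shows "affine hull S = UNIV"
proof -
  obtain B where B: "affine hull B = affine hull S" "\<not> affine_dependent B"
    "of_nat (card B) = aff_dim S + 1"
    using aff_dim_basis_exists by blast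
  have "finite B"
    using B(2) aff_independent_finite by blast
  moreover have "\<not> coplanar B"
    using assms B(1) coplanar_affine_hull_coplanar by metis
  ultimately have "card B > 3"
    using coplanar_small by (metis not_le_imp_less)
  then have "aff_dim S \<ge> 3"
    using B(3) by linarith
  moreover have "aff_dim S \<le> 3"
    using aff_dim_le_DIM[of S] by simp
  ultimately show ?thesis
    using aff_dim_eq_full[of S] by simp
qed

lemma coplanar_if_subset_plane:
  assumes "S \<subseteq> affine hull {u, v, w}"
  shows "coplanar S"
  using assms unfolding coplanar_def by blast

lemma affine_line_eq_hull:
  fixes L :: "(real^3) set"
  assumes "affine L" "aff_dim L = 1" "x \<in> L" "y \<in> L" "x \<noteq> y"
  shows "L = affine hull {x, y}"
proof -
  have "affine hull {x, y} \<subseteq> L"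
    using assms by (simp add: hull_minimal)
  then show ?thesis
    using affine_dim_equal[of "affine hull {x, y}" L] assms by auto
qed

lemma affine_line_subset:
  fixes L :: "(real^3) set"
  assumes "affine L" "aff_dim L = 1" "x \<in> L" "y \<in> L" "x \<noteq> y"
    and "affine P" "x \<in> P" "y \<in> P"
  shows "L \<subseteq> P"
  using affine_line_eq_hull[OF assms(1-5)] assms(6-8) by (simp add: hull_minimal)

lemma affine_segment_endpoint:
  fixes P :: "(real^3) set"
  assumes "affine P" "p \<in> P" "x \<in> P" "x \<in> closed_segment p q" "x \<noteq> p"
  shows "q \<in> P"
proof -
  have "p \<noteq> q"
    using assms by auto
  have "affine hull {p, q} \<subseteq> P"
    using affine_line_subset[of "affine hull {p, q}" p x P] assms \<open>p \<noteq> q\<close>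
      closed_segment_subset[of p "affine hull {p, q}" q]
    by (auto simp: hull_inc affine_imp_convex)
  then show ?thesis
    by (simp add: hull_inc subset_iff)
qed

text \<open>\<open>P\<close> contains two points of the segment, hence its whole line. Mostly used
  contrapositively: a segment with an endpoint off a plane or line meets it at most once.\<close>

lemma affine_segment_subset:
  fixes P :: "(real^3) set"
  assumes "affine P" "x \<in> P" "y \<in> P" "x \<noteq> y"
    "x \<in> closed_segment p q" "y \<in> closed_segment p q"
  shows "p \<in> P"
proof -
  have "p \<noteq> q"
    using assms by auto
  have "affine hull {p, q} \<subseteq> P"
    using affine_line_subset[of "affine hull {p, q}" x y P] assms \<open>p \<noteq> q\<close>
      closed_segment_subset[of p "affine hull {p, q}" q]
    by (auto simp: hull_inc affine_imp_convex)
  then show ?thesis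
    by (simp add: hull_inc subset_iff)
qed

subsection \<open>The quadric through three skew lines\<close>

text \<open>The polarization of the quadratic polynomial given by \<open>A\<close>, \<open>b\<close>, \<open>c\<close>, in homogeneous
  coordinates: the point \<open>x\<close> is represented by \<open>(x, 1)\<close>.\<close>

definition quad_form :: "real^3^3 \<Rightarrow> real^3 \<Rightarrow> real \<Rightarrow> (real^3) \<times> real \<Rightarrow> (real^3) \<times> real \<Rightarrow> real"
  where "quad_form A b c u v =
    fst u \<bullet> (A *v fst v) + (snd u * (b \<bullet> fst v) + snd v * (b \<bullet> fst u)) / 2 + c * snd u * snd v"

lemma bilinear_quad_form: "bilinear (quad_form A b c)"
  unfolding bilinear_def quad_form_def
  by (auto intro!: linearI simp: algebra_simps inner_add_left inner_add_right
      matrix_vector_right_distrib add_divide_distrib matrix_vector_mult_scaleR)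

lemma quad_form_commute:
  assumes "transpose A = A"
  shows "quad_form A b c u v = quad_form A b c v u"
proof -
  have "fst u \<bullet> (A *v fst v) = fst v \<bullet> (A *v fst u)"
    by (metis assms dot_lmul_matrix inner_commute transpose_matrix_vector)
  then show ?thesis
    by (simp add: quad_form_def)
qed

lemma quad_form_diag: "quad_form A b c (x, 1) (x, 1) = x \<bullet> (A *v x) + b \<bullet> x + c"
  by (simp add: quad_form_def)

text \<open>Polarization: a symmetric form that vanishes on the diagonal vanishes everywhere, and
  then so does its block \<open>A\<close>.\<close>

lemma quad_form_nonzero:
  assumes "transpose A = A" "A \<noteq> 0"
  shows "\<exists>v. quad_form A b c v v \<noteq> 0"
proof (rule ccontr)
  assume "\<not> ?thesis"
  then have z: "quad_form A b c v v = 0" for v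
    by blast
  note bil = bilinear_quad_form[of A b c]
  have "quad_form A b c u v = 0" for u v
    using z[of "u + v"] z[of u] z[of v] quad_form_commute[OF assms(1), of b c u v]
    by (simp add: bilinear_ladd[OF bil] bilinear_radd[OF bil])
  \<comment> \<open>Vectors with last coordinate 0 see only \<open>A\<close>; this value is the
    squared norm of \<open>A *v x\<close>.\<close>
  from this[of "(A *v x, 0)" "(x, 0)" for x] have "A *v x = 0" for x
    by (simp add: quad_form_def)
  then have "A = 0"
    by (simp add: matrix_eq)
  with assms show False
    by simp
qed

text \<open>Along the line, \<open>q\<close> is a polynomial of degree at most 2 in the parameter,
  with the three roots 0, 1 and \<open>t\<close>.\<close>

lemma quadratic_vanishes_on_line:
  fixes x y :: "real^3"
  fixes A :: "real^3^3" and b :: "real^3" and c :: real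
  defines "q \<equiv> \<lambda>x. x \<bullet> (A *v x) + b \<bullet> x + c"
  assumes "q x = 0" "q y = 0" "q ((1 - t) *\<^sub>R x + t *\<^sub>R y) = 0" "t \<noteq> 0" "t \<noteq> 1"
  shows "q ((1 - s) *\<^sub>R x + s *\<^sub>R y) = 0"
proof -
  let ?B = "quad_form A b c"
  note bil = bilinear_quad_form[of A b c]
  have q: "q z = ?B (z, 1) (z, 1)" for z
    by (simp add: q_def quad_form_diag)
  define m where "m = ?B (x, 1) (y, 1) + ?B (y, 1) (x, 1)"
  have *: "q ((1 - r) *\<^sub>R x + r *\<^sub>R y) = (1 - r) * r * m" for r
  proof -
    have "((1 - r) *\<^sub>R x + r *\<^sub>R y, 1::real) = (1 - r) *\<^sub>R (x, 1) + r *\<^sub>R (y, 1)"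
      by simp
    then show ?thesis
      using assms(2,3) unfolding q m_def
      by (simp only: bilinear_ladd[OF bil] bilinear_radd[OF bil] bilinear_lmul[OF bil]
        bilinear_rmul[OF bil]) (simp add: algebra_simps)
  qed
  from *[of t] assms(4-6) have "m = 0"
    by simp
  with * show ?thesis
    by simp
qed

text \<open>Used twice: to put transversals of three generating lines on the quadric, and then to
  put the fourth edge on it.\<close>

lemma quadric_contains_line:
  assumes "quadric Q" "affine L" "aff_dim L = 1"
    and "{x, y, z} \<subseteq> L" "{x, y, z} \<subseteq> Q" "x \<noteq> y" "x \<noteq> z" "y \<noteq> z"
  shows "L \<subseteq> Q"
proof
  fix w assume "w \<in> L"
  have L: "L = affine hull {x, y}"
    using assms affine_line_eq_hull by auto
  obtain A b c where Q: "Q = {x. x \<bullet> (A *v x) + b \<bullet> x + c = 0}"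
    using assms(1) unfolding quadric_def by blast
  have rep: "\<exists>s. w = (1 - s) *\<^sub>R x + s *\<^sub>R y" if "w \<in> L" for w
  proof -
    from that obtain r s where "w = r *\<^sub>R x + s *\<^sub>R y" "r + s = 1"
      unfolding L affine_hull_2 by blast
    moreover from this(2) have "r = 1 - s"
      by simp
    ultimately show ?thesis
      by blast
  qed
  obtain s where s: "w = (1 - s) *\<^sub>R x + s *\<^sub>R y"
    using rep \<open>w \<in> L\<close> by blast
  obtain t where t: "z = (1 - t) *\<^sub>R x + t *\<^sub>R y"
    using rep assms(4) by blast
  have "t \<noteq> 0" "t \<noteq> 1"
    using t assms by auto
  with assms(5) show "w \<in> Q"
    unfolding Q s using quadratic_vanishes_on_line[where A=A and b=b and c=c and x=x and y=y and t=t and s=s] t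
    by simp
qed

section \<open>Uniqueness of the quadric, in homogeneous coordinates\<close>

text \<open>Up to symmetry, the only values on basis vectors that can be nonzero are
  \<open>B e1 f2 = - B e2 f1\<close>. So \<open>B\<close> is determined up to a nonzero factor, and
  its zero set does not depend on \<open>B\<close>.\<close>

lemma bilinear_zero_cone:
  fixes B :: "'v::real_vector \<Rightarrow> 'v \<Rightarrow> real"
  assumes bil: "bilinear B" and sym: "\<And>u v. B u v = B v u"
    and E: "B e1 e1 = 0" "B e2 e2 = 0" "B e1 e2 = 0"
    and F: "B f1 f1 = 0" "B f2 f2 = 0" "B f1 f2 = 0"
    and G: "B (e1 + f1) (e1 + f1) = 0" "B (e2 + f2) (e2 + f2) = 0" "B (e1 + f1) (e2 + f2) = 0"
    and span: "\<And>v. \<exists>k l m n. v = k *\<^sub>R e1 + l *\<^sub>R e2 + m *\<^sub>R f1 + n *\<^sub>R f2"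
    and nz: "\<exists>v. B v v \<noteq> 0"
  shows "B v v = 0 \<longleftrightarrow>
    (\<exists>k l m n. v = k *\<^sub>R e1 + l *\<^sub>R e2 + m *\<^sub>R f1 + n *\<^sub>R f2 \<and> k * n = l * m)"
proof -
  note expand = bilinear_ladd[OF bil] bilinear_radd[OF bil] bilinear_lmul[OF bil] bilinear_rmul[OF bil]
  have 1: "B e1 f1 = 0" "B e2 f2 = 0"
    using G E F sym[of f1 e1] sym[of f2 e2] by (simp_all add: expand)
  have 2: "B e2 f1 = - B e1 f2"
    using G(3) E F sym[of f1 e2] by (simp add: expand)
  have 3: "B v v = 2 * B e1 f2 * (k * n - l * m)"
    if "v = k *\<^sub>R e1 + l *\<^sub>R e2 + m *\<^sub>R f1 + n *\<^sub>R f2" for v k l m n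
    using 1 2 E F sym[of f1 e1] sym[of f1 e2] sym[of f2 e1] sym[of f2 e2] sym[of e2 e1] sym[of f2 f1]
    unfolding that by (simp add: expand algebra_simps)
  have "B e1 f2 \<noteq> 0"
    using nz span 3 by (metis mult_zero_left mult_zero_right)
  with 3 span show ?thesis
    by (metis eq_iff_diff_eq_0 mult_eq_0_iff zero_neq_numeral)
qed

lemma span_doubleton:
  fixes x y :: "'a::real_vector"
  shows "span {x, y} = {k *\<^sub>R x + l *\<^sub>R y |k l. True}"
  by (auto simp: span_insert span_singleton eq_diff_eq diff_eq_eq ac_simps)

text \<open>Four non-coplanar points span space affinely, so their lifts span the four-dimensional
  space linearly.\<close>

lemma lifted_lines_sum:
  fixes a b c d :: "real^3"
  assumes "\<not> coplanar {a, b, c, d}"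
  shows "{x + y |x y. x \<in> span {(a, 1::real), (b, 1)} \<and> y \<in> span {(c, 1), (d, 1)}} = UNIV"
    (is "?S = UNIV")
proof -
  have "subspace ?S"
    by (intro subspace_sums subspace_span)
  have "(x, 1) \<in> ?S" for x
  proof -
    have "x \<in> affine hull {a, b, c, d}"
      using affine_hull_eq_UNIV_if_not_coplanar[OF assms] by simp
    then obtain u r s where "x - u *\<^sub>R a - r *\<^sub>R b - s *\<^sub>R c = (1 - u - r - s) *\<^sub>R d"
      by (auto simp: affine_hull_finite affine_hull_finite_step) metis
    then obtain t where x: "x = u *\<^sub>R a + r *\<^sub>R b + (s *\<^sub>R c + t *\<^sub>R d)" "u + r + (s + t) = 1"
      using that[of "1 - u - r - s"] by (simp add: diff_eq_eq ac_simps)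
    have "(x, 1::real) = (u *\<^sub>R (a, 1) + r *\<^sub>R (b, 1)) + (s *\<^sub>R (c, 1) + t *\<^sub>R (d, 1))"
      using x by simp
    moreover have "u *\<^sub>R (a, 1) + r *\<^sub>R (b, 1) \<in> span {(a, 1::real), (b, 1)}"
      "s *\<^sub>R (c, 1) + t *\<^sub>R (d, 1) \<in> span {(c, 1::real), (d, 1)}"
      unfolding span_doubleton by blast+
    ultimately show ?thesis
      by blast
  qed
  \<comment> \<open>\<open>(0, 1)\<close> is the lift of the origin; adding multiples of it reaches
    every last coordinate.\<close>
  then have "(x, 1) + (s - 1) *\<^sub>R (0, 1) \<in> ?S" for x s
    by (intro subspace_add[OF \<open>subspace ?S\<close>] subspace_scale[OF \<open>subspace ?S\<close>])
  then have "(x, s) \<in> ?S" for x s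
    by (auto simp del: mem_Collect_eq)
  then show ?thesis
    by auto
qed

text \<open>Dimension count: two spans of dimension at most 2 have a sum of dimension 4.\<close>

lemma lifted_lines_disjoint:
  fixes a b c d :: "real^3"
  assumes "\<not> coplanar {a, b, c, d}"
  shows "span {(a, 1::real), (b, 1)} \<inter> span {(c, 1), (d, 1)} = {0}" (is "?L \<inter> ?M = {0}")
proof -
  have le: "dim (span {p, q}) \<le> 2" for p q :: "(real^3) \<times> real"
    by (rule order_trans[OF dim_le_card[of _ "{p, q}"]]) (auto simp: card_insert_if)
  have "4 + dim (?L \<inter> ?M) = dim ?L + dim ?M"
    using dim_sums_Int[of ?L ?M] lifted_lines_sum[OF assms] by simp
  then have "dim (?L \<inter> ?M) = 0"
    using le[of "(a, 1)" "(b, 1)"] le[of "(c, 1)" "(d, 1)"] by linarith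
  then show ?thesis
    using span_0 by (auto simp: dim_eq_0)
qed

text \<open>In homogeneous coordinates two skew lines are complementary planes, and a line skew to both
  is the graph of an isomorphism between them.\<close>

lemma skew_lines_basis:
  fixes a\<^sub>1 b\<^sub>1 a\<^sub>2 b\<^sub>2 a\<^sub>3 b\<^sub>3 :: "real^3"
  assumes "\<not> coplanar {a\<^sub>1, b\<^sub>1, a\<^sub>2, b\<^sub>2}" "\<not> coplanar {a\<^sub>1, b\<^sub>1, a\<^sub>3, b\<^sub>3}" "\<not> coplanar {a\<^sub>2, b\<^sub>2, a\<^sub>3, b\<^sub>3}"
  obtains e\<^sub>1 e\<^sub>2 f\<^sub>1 f\<^sub>2 where
    "e\<^sub>1 \<in> span {(a\<^sub>1, 1::real), (b\<^sub>1, 1)}" "e\<^sub>2 \<in> span {(a\<^sub>1, 1), (b\<^sub>1, 1)}"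
    "f\<^sub>1 \<in> span {(a\<^sub>2, 1), (b\<^sub>2, 1)}" "f\<^sub>2 \<in> span {(a\<^sub>2, 1), (b\<^sub>2, 1)}"
    "(a\<^sub>3, 1) = e\<^sub>1 + f\<^sub>1" "(b\<^sub>3, 1) = e\<^sub>2 + f\<^sub>2"
    "\<And>v. \<exists>k l m n. v = k *\<^sub>R e\<^sub>1 + l *\<^sub>R e\<^sub>2 + m *\<^sub>R f\<^sub>1 + n *\<^sub>R f\<^sub>2"
proof -
  let ?L = "\<lambda>a b. span {(a, 1::real), (b, 1)}"
  obtain e\<^sub>1 f\<^sub>1 where 1: "(a\<^sub>3, 1) = e\<^sub>1 + f\<^sub>1" "e\<^sub>1 \<in> ?L a\<^sub>1 b\<^sub>1" "f\<^sub>1 \<in> ?L a\<^sub>2 b\<^sub>2"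
    using lifted_lines_sum[OF assms(1)] by blast
  obtain e\<^sub>2 f\<^sub>2 where 2: "(b\<^sub>3, 1) = e\<^sub>2 + f\<^sub>2" "e\<^sub>2 \<in> ?L a\<^sub>1 b\<^sub>1" "f\<^sub>2 \<in> ?L a\<^sub>2 b\<^sub>2"
    using lifted_lines_sum[OF assms(1)] by blast
  have part: "\<exists>k n. v = k *\<^sub>R (a\<^sub>3, 1) + n *\<^sub>R (b\<^sub>3, 1)" if "v \<in> ?L a\<^sub>3 b\<^sub>3" for v
    using that unfolding span_doubleton by blast
  \<comment> \<open>Split \<open>v\<close> along the second and third planes and rewrite the third
    part by the \<open>e\<close> and \<open>f\<close> vectors. What remains lies in both the first
    and the second plane, hence is 0.\<close>
  have L1: "\<exists>k l. v = k *\<^sub>R e\<^sub>1 + l *\<^sub>R e\<^sub>2" if v: "v \<in> ?L a\<^sub>1 b\<^sub>1" for v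
  proof -
    obtain y z where "v = y + z" "y \<in> ?L a\<^sub>2 b\<^sub>2" "z \<in> ?L a\<^sub>3 b\<^sub>3"
      using lifted_lines_sum[OF assms(3)] by blast
    moreover obtain k l where "z = k *\<^sub>R (a\<^sub>3, 1) + l *\<^sub>R (b\<^sub>3, 1)"
      using part calculation(3) by blast
    ultimately have "v - (k *\<^sub>R e\<^sub>1 + l *\<^sub>R e\<^sub>2) = y + k *\<^sub>R f\<^sub>1 + l *\<^sub>R f\<^sub>2"
      unfolding 1 2 by (simp add: algebra_simps)
    moreover have "v - (k *\<^sub>R e\<^sub>1 + l *\<^sub>R e\<^sub>2) \<in> ?L a\<^sub>1 b\<^sub>1"
      using v 1 2 by (intro span_diff span_add span_scale)
    moreover have "y + k *\<^sub>R f\<^sub>1 + l *\<^sub>R f\<^sub>2 \<in> ?L a\<^sub>2 b\<^sub>2"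
      using \<open>y \<in> _\<close> 1 2 by (intro span_add span_scale)
    ultimately have "v - (k *\<^sub>R e\<^sub>1 + l *\<^sub>R e\<^sub>2) = 0"
      using lifted_lines_disjoint[OF assms(1)] by auto
    then show ?thesis
      by (metis eq_iff_diff_eq_0)
  qed
  have L2: "\<exists>k l. v = k *\<^sub>R f\<^sub>1 + l *\<^sub>R f\<^sub>2" if v: "v \<in> ?L a\<^sub>2 b\<^sub>2" for v
  proof -
    obtain y z where "v = y + z" "y \<in> ?L a\<^sub>1 b\<^sub>1" "z \<in> ?L a\<^sub>3 b\<^sub>3"
      using lifted_lines_sum[OF assms(2)] by blast
    moreover obtain k l where "z = k *\<^sub>R (a\<^sub>3, 1) + l *\<^sub>R (b\<^sub>3, 1)"
      using part calculation(3) by blast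
    ultimately have "v - (k *\<^sub>R f\<^sub>1 + l *\<^sub>R f\<^sub>2) = y + k *\<^sub>R e\<^sub>1 + l *\<^sub>R e\<^sub>2"
      unfolding 1 2 by (simp add: algebra_simps)
    moreover have "v - (k *\<^sub>R f\<^sub>1 + l *\<^sub>R f\<^sub>2) \<in> ?L a\<^sub>2 b\<^sub>2"
      using v 1 2 by (intro span_diff span_add span_scale)
    moreover have "y + k *\<^sub>R e\<^sub>1 + l *\<^sub>R e\<^sub>2 \<in> ?L a\<^sub>1 b\<^sub>1"
      using \<open>y \<in> _\<close> 1 2 by (intro span_add span_scale)
    ultimately have "v - (k *\<^sub>R f\<^sub>1 + l *\<^sub>R f\<^sub>2) = 0"
      using lifted_lines_disjoint[OF assms(1)] by auto
    then show ?thesis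
      by (metis eq_iff_diff_eq_0)
  qed
  have "\<exists>k l m n. v = k *\<^sub>R e\<^sub>1 + l *\<^sub>R e\<^sub>2 + m *\<^sub>R f\<^sub>1 + n *\<^sub>R f\<^sub>2" for v
  proof -
    obtain x y where "v = x + y" "x \<in> ?L a\<^sub>1 b\<^sub>1" "y \<in> ?L a\<^sub>2 b\<^sub>2"
      using lifted_lines_sum[OF assms(1)] by blast
    with L1[of x] L2[of y] show ?thesis
      by (metis add.assoc)
  qed
  with 1 2 that show ?thesis
    by blast
qed

text \<open>The form vanishes at the lifts of both points and of their midpoint, which forces the
  mixed value to vanish too.\<close>

lemma quad_form_zero_on_lifted_line:
  assumes "transpose A = A" "affine hull {a, b'} \<subseteq> {x. x \<bullet> (A *v x) + b \<bullet> x + c = 0}"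
    and "u \<in> span {(a, 1), (b', 1)}" "v \<in> span {(a, 1), (b', 1)}"
  shows "quad_form A b c u v = 0"
proof -
  let ?B = "quad_form A b c"
  note bil = bilinear_quad_form[of A b c]
  note expand = bilinear_ladd[OF bil] bilinear_radd[OF bil] bilinear_lmul[OF bil] bilinear_rmul[OF bil]
  have line: "?B (x, 1) (x, 1) = 0" if "x \<in> affine hull {a, b'}" for x
    using assms(2) that by (auto simp: quad_form_diag)
  have 1: "?B (a, 1) (a, 1) = 0" "?B (b', 1) (b', 1) = 0"
    by (intro line hull_inc; simp)+
  have "(1/2) *\<^sub>R a + (1/2) *\<^sub>R b' \<in> affine hull {a, b'}"
    unfolding affine_hull_2 by force
  then have "?B ((1/2) *\<^sub>R (a, 1) + (1/2) *\<^sub>R (b', 1)) ((1/2) *\<^sub>R (a, 1) + (1/2) *\<^sub>R (b', 1)) = 0"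
    using line by fastforce
  then have 2: "?B (a, 1) (b', 1) = 0" "?B (b', 1) (a, 1) = 0"
    using 1 quad_form_commute[OF assms(1), of b c "(b', 1)" "(a, 1)"] by (simp_all only: expand) auto
  have part: "\<exists>k n. v = k *\<^sub>R (a, 1) + n *\<^sub>R (b', 1)" if "v \<in> span {(a, 1), (b', 1)}" for v :: "(real^3) \<times> real"
    using that unfolding span_doubleton by blast
  obtain k l m n where "u = k *\<^sub>R (a, 1) + l *\<^sub>R (b', 1)" "v = m *\<^sub>R (a, 1) + n *\<^sub>R (b', 1)"
    using part assms(3,4) by meson
  then show ?thesis
    using 1 2 by (simp only: expand) simp
qed

text \<open>The zero set, written in the basis adapted to the three lines, involves no coefficient
  of the polynomial.\<close>

lemma quadric_unique:
  fixes a\<^sub>1 b\<^sub>1 a\<^sub>2 b\<^sub>2 a\<^sub>3 b\<^sub>3 :: "real^3"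
  assumes "\<not> coplanar {a\<^sub>1, b\<^sub>1, a\<^sub>2, b\<^sub>2}" "\<not> coplanar {a\<^sub>1, b\<^sub>1, a\<^sub>3, b\<^sub>3}" "\<not> coplanar {a\<^sub>2, b\<^sub>2, a\<^sub>3, b\<^sub>3}"
    and Q: "quadric Q" "affine hull {a\<^sub>1, b\<^sub>1} \<subseteq> Q" "affine hull {a\<^sub>2, b\<^sub>2} \<subseteq> Q" "affine hull {a\<^sub>3, b\<^sub>3} \<subseteq> Q"
    and Q': "quadric Q'" "affine hull {a\<^sub>1, b\<^sub>1} \<subseteq> Q'" "affine hull {a\<^sub>2, b\<^sub>2} \<subseteq> Q'" "affine hull {a\<^sub>3, b\<^sub>3} \<subseteq> Q'"
  shows "Q = Q'"
proof -
  obtain e\<^sub>1 e\<^sub>2 f\<^sub>1 f\<^sub>2 where basis: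
    "e\<^sub>1 \<in> span {(a\<^sub>1, 1::real), (b\<^sub>1, 1)}" "e\<^sub>2 \<in> span {(a\<^sub>1, 1), (b\<^sub>1, 1)}"
    "f\<^sub>1 \<in> span {(a\<^sub>2, 1), (b\<^sub>2, 1)}" "f\<^sub>2 \<in> span {(a\<^sub>2, 1), (b\<^sub>2, 1)}"
    "(a\<^sub>3, 1) = e\<^sub>1 + f\<^sub>1" "(b\<^sub>3, 1) = e\<^sub>2 + f\<^sub>2"
    "\<And>v. \<exists>k l m n. v = k *\<^sub>R e\<^sub>1 + l *\<^sub>R e\<^sub>2 + m *\<^sub>R f\<^sub>1 + n *\<^sub>R f\<^sub>2"
    using skew_lines_basis[OF assms(1-3)] by metis
  have "R = {x. \<exists>k l m n. (x, 1) = k *\<^sub>R e\<^sub>1 + l *\<^sub>R e\<^sub>2 + m *\<^sub>R f\<^sub>1 + n *\<^sub>R f\<^sub>2 \<and> k * n = l * m}"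
    if R: "quadric R" "affine hull {a\<^sub>1, b\<^sub>1} \<subseteq> R" "affine hull {a\<^sub>2, b\<^sub>2} \<subseteq> R" "affine hull {a\<^sub>3, b\<^sub>3} \<subseteq> R" for R
  proof -
    obtain A b c where A: "transpose A = A" "A \<noteq> 0" "R = {x. x \<bullet> (A *v x) + b \<bullet> x + c = 0}"
      using R(1) unfolding quadric_def by blast
    have 3: "e\<^sub>1 + f\<^sub>1 \<in> span {(a\<^sub>3, 1), (b\<^sub>3, 1)}" "e\<^sub>2 + f\<^sub>2 \<in> span {(a\<^sub>3, 1), (b\<^sub>3, 1)}"
      by (simp_all add: span_base flip: basis(5,6))
    note zero = quad_form_zero_on_lifted_line[OF A(1)]
    show ?thesis
      unfolding A(3)
      by (subst quad_form_diag[symmetric],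
          subst bilinear_zero_cone[where B = "quad_form A b c", OF bilinear_quad_form
            quad_form_commute[OF A(1)] zero zero zero zero zero zero zero zero zero basis(7)
            quad_form_nonzero[OF A(1,2)]])
        (use R(2-4) A(3) basis(1-4) 3 in auto)
  qed
  from this[OF Q] this[OF Q'] show ?thesis
    by simp
qed

text \<open>A quadratic polynomial with symmetric matrix vanishes on three given lines if it satisfies three
  linear conditions for the symmetry and three for each line: 12 conditions on 13 coefficients.\<close>

lemma quadric_exists:
  fixes a\<^sub>1 b\<^sub>1 a\<^sub>2 b\<^sub>2 a\<^sub>3 b\<^sub>3 :: "real^3"
  assumes "\<not> coplanar {a\<^sub>1, b\<^sub>1, a\<^sub>2, b\<^sub>2}"
  shows "\<exists>Q. quadric Q \<and> affine hull {a\<^sub>1, b\<^sub>1} \<subseteq> Q \<and> affine hull {a\<^sub>2, b\<^sub>2} \<subseteq> Q \<and> affine hull {a\<^sub>3, b\<^sub>3} \<subseteq> Q"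
proof -
  define q where "q = (\<lambda>(A :: real^3^3, b :: real^3, c :: real) x. x \<bullet> (A *v x) + b \<bullet> x + c)"
  \<comment> \<open>Vanishing at two points and their midpoint suffices for vanishing on the
    line.\<close>
  define line where "line p a b = (q p a, q p b, q p ((1/2) *\<^sub>R a + (1/2) *\<^sub>R b))" for p a b
  define f where "f p = (line p a\<^sub>1 b\<^sub>1, line p a\<^sub>2 b\<^sub>2, line p a\<^sub>3 b\<^sub>3,
    case p of (A, _) \<Rightarrow> (A $ 1 $ 2 - A $ 2 $ 1, A $ 1 $ 3 - A $ 3 $ 1, A $ 2 $ 3 - A $ 3 $ 2))" for p
  have q_add: "q (p + p') x = q p x + q p' x" for p p' x
    by (cases p; cases p')
      (simp add: q_def matrix_vector_mult_add_rdistrib inner_add_left inner_add_right)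
  have q_scale: "q (r *\<^sub>R p) x = r *\<^sub>R q p x" for p r x
    by (cases p) (simp add: q_def algebra_simps flip: scaleR_matrix_vector_assoc)
  have "linear f"
  proof (rule linearI)
    show "f (p + p') = f p + f p'" for p p'
      by (cases p; cases p') (simp add: f_def line_def q_add del: add_Pair, simp)
    show "f (r *\<^sub>R p) = r *\<^sub>R f p" for r p
      by (cases p) (simp add: f_def line_def q_scale del: scaleR_Pair, simp add: algebra_simps)
  qed
  have "\<not> inj f"
  proof
    assume "inj f"
    then have "dim (range f) = dim (UNIV :: ((real^3^3) \<times> (real^3) \<times> real) set)"
      using dim_image_eq[OF \<open>linear f\<close>] by (auto intro: inj_on_subset)
    moreover have "dim (range f) \<le> 12"
      using dim_subset_UNIV[of "range f"] by simp
    ultimately show False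
      by simp
  qed
  then obtain A b c where p: "(A, b, c) \<noteq> 0" "f (A, b, c) = 0"
    using linear_injective_0[OF \<open>linear f\<close>] by (metis prod_cases3)
  have sym: "transpose A = A"
    using p(2) unfolding f_def
    by (simp add: vec_eq_iff transpose_def forall_3 zero_prod_def)
  let ?Q = "{x. x \<bullet> (A *v x) + b \<bullet> x + c = 0}"
  have line: "affine hull {a', b'} \<subseteq> ?Q" if "line (A, b, c) a' b' = 0" for a' b'
  proof -
    have "q (A, b, c) (r *\<^sub>R a' + s *\<^sub>R b') = 0" if "r + s = 1" for r s
    proof -
      from that have "r = 1 - s"
        by simp
      then show ?thesis
        using quadratic_vanishes_on_line[of a' A b c b' "1/2" s] \<open>line (A, b, c) a' b' = 0\<close>
        by (simp add: line_def q_def zero_prod_def)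
    qed
    then show ?thesis
      unfolding affine_hull_2 q_def by auto
  qed
  have Q: "affine hull {a\<^sub>1, b\<^sub>1} \<subseteq> ?Q" "affine hull {a\<^sub>2, b\<^sub>2} \<subseteq> ?Q" "affine hull {a\<^sub>3, b\<^sub>3} \<subseteq> ?Q"
    by (intro line; use p(2) in \<open>simp add: f_def zero_prod_def\<close>)+
  \<comment> \<open>Otherwise an affine function vanishes on four non-coplanar points, so all
    coefficients are 0.\<close>
  have "A \<noteq> 0"
  proof
    assume "A = 0"
    then have "{a\<^sub>1, b\<^sub>1, a\<^sub>2, b\<^sub>2} \<subseteq> {x. b \<bullet> x = - c}"
      using Q(1,2) hull_inc[of _ "{a\<^sub>1, b\<^sub>1}" affine] hull_inc[of _ "{a\<^sub>2, b\<^sub>2}" affine]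
      by (auto simp: subset_iff eq_neg_iff_add_eq_0)
    then have "affine hull {a\<^sub>1, b\<^sub>1, a\<^sub>2, b\<^sub>2} \<subseteq> {x. b \<bullet> x = - c}"
      by (simp add: affine_hyperplane hull_minimal)
    then have "b \<bullet> x = - c" for x
      using affine_hull_eq_UNIV_if_not_coplanar[OF assms] by auto
    from this[of 0] this[of b] have "b = 0" "c = 0"
      by auto
    with \<open>A = 0\<close> p(1) show False
      by (simp add: zero_prod_def)
  qed
  with sym Q show ?thesis
    unfolding quadric_def by (intro exI[of _ ?Q]) auto
qed

text \<open>Existence and uniqueness make the definite description in
  \<open>generated_quadric\<close> meaningful.\<close>

lemma generated_quadric:
  fixes a\<^sub>1 b\<^sub>1 a\<^sub>2 b\<^sub>2 a\<^sub>3 b\<^sub>3 :: "real^3"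
  assumes "\<not> coplanar {a\<^sub>1, b\<^sub>1, a\<^sub>2, b\<^sub>2}" "\<not> coplanar {a\<^sub>1, b\<^sub>1, a\<^sub>3, b\<^sub>3}" "\<not> coplanar {a\<^sub>2, b\<^sub>2, a\<^sub>3, b\<^sub>3}"
  defines "Q \<equiv> generated_quadric (closed_segment a\<^sub>1 b\<^sub>1) (closed_segment a\<^sub>2 b\<^sub>2) (closed_segment a\<^sub>3 b\<^sub>3)"
  shows "quadric Q" "affine hull {a\<^sub>1, b\<^sub>1} \<subseteq> Q" "affine hull {a\<^sub>2, b\<^sub>2} \<subseteq> Q" "affine hull {a\<^sub>3, b\<^sub>3} \<subseteq> Q"
proof -
  let ?P = "\<lambda>Q. quadric Q \<and> affine hull {a\<^sub>1, b\<^sub>1} \<subseteq> Q \<and> affine hull {a\<^sub>2, b\<^sub>2} \<subseteq> Q \<and> affine hull {a\<^sub>3, b\<^sub>3} \<subseteq> Q"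
  have "\<exists>!Q. ?P Q"
    using quadric_exists[OF assms(1)] quadric_unique[OF assms(1-3)] by (metis (no_types, lifting))
  then have "?P (THE Q. ?P Q)"
    by (rule theI')
  then show "quadric Q" "affine hull {a\<^sub>1, b\<^sub>1} \<subseteq> Q" "affine hull {a\<^sub>2, b\<^sub>2} \<subseteq> Q" "affine hull {a\<^sub>3, b\<^sub>3} \<subseteq> Q"
    unfolding Q_def generated_quadric_def by simp_all
qed

subsection \<open>Common transversals of segments\<close>

text \<open>Injectivity of \<open>x\<close> prevents a vertex shared by two segments from serving
  for both.\<close>

definition transversals :: "('i \<Rightarrow> (real^3) set) \<Rightarrow> 'i set \<Rightarrow> (real^3) set set" where
  "transversals S I =
     {L. affine L \<and> aff_dim L = 1 \<and> (\<exists>x. inj_on x I \<and> (\<forall>i\<in>I. x i \<in> L \<inter> S i))}"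

lemma transversals_mono: "J \<subseteq> I \<Longrightarrow> transversals S I \<subseteq> transversals S J"
  unfolding transversals_def by (blast intro: inj_on_subset)

lemma transversal_of_adjacent_segments_subset_plane:
  assumes L: "L \<in> transversals S {i, j}" "i \<noteq> j"
    and S: "S i = closed_segment p q" "S j = closed_segment q r"
  shows "L \<subseteq> affine hull {p, q, r}"
proof -
  let ?P = "affine hull {p, q, r}"
  obtain x where x: "affine L" "aff_dim L = 1" "inj_on x {i, j}" "x i \<in> L \<inter> S i" "x j \<in> L \<inter> S j"
    using L(1) by (auto simp: transversals_def)
  have "S i \<subseteq> ?P" "S j \<subseteq> ?P"
    unfolding S by (intro closed_segment_subset affine_imp_convex affine_affine_hull; simp add: hull_inc)+
  moreover have "x i \<noteq> x j"
    using x(3) L(2) by simp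
  ultimately show ?thesis
    using affine_line_subset[of L "x i" "x j" ?P] x by auto
qed

text \<open>The first two segments force \<open>L\<close> into the plane of \<open>p\<close>,
  \<open>q\<close>, \<open>r\<close>, which the third meets only in \<open>r\<close>. The conclusion
  rules out lines that avoid the vertices.\<close>

lemma no_transversal_of_consecutive_segments:
  assumes "L \<in> transversals S {i, j, k}" "i \<noteq> j"
    and S: "S i = closed_segment p q" "S j = closed_segment q r" "S k = closed_segment r s"
    and "\<not> coplanar {p, q, r, s}"
  shows "r \<in> L"
proof (rule ccontr)
  assume "r \<notin> L"
  let ?P = "affine hull {p, q, r}"
  have "L \<in> transversals S {i, j}"
    using assms(1) transversals_mono[of "{i, j}" "{i, j, k}" S] by blast
  then have "L \<subseteq> ?P"
    using transversal_of_adjacent_segments_subset_plane[of L S i j] S assms(2) by blast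
  moreover obtain x where "x \<in> L" "x \<in> closed_segment r s"
    using assms(1) S by (auto simp: transversals_def)
  ultimately have "s \<in> ?P"
    using affine_segment_endpoint[of ?P r x s] \<open>r \<notin> L\<close> by (auto simp: hull_inc)
  then have "{p, q, r, s} \<subseteq> ?P"
    by (auto simp: hull_inc)
  with assms(6) show False
    using coplanar_if_subset_plane by blast
qed

text \<open>Every transversal lies in the plane of \<open>p\<close>, \<open>q\<close>,
  \<open>r\<close>. The other two segments each have an endpoint off it, so each meets it in at most
  one point, and these two points determine the line.\<close>

lemma transversal_with_adjacent_segments_unique:
  assumes "L \<in> transversals S {i, j, k, l}" "L' \<in> transversals S {i, j, k, l}" "distinct [i, j, k, l]"
    and S: "S i = closed_segment p q" "S j = closed_segment q r" "S k = closed_segment a b" "S l = closed_segment c d"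
    and "\<not> coplanar {p, q, r, a}" "\<not> coplanar {p, q, r, c}"
  shows "L = L'"
proof -
  let ?P = "affine hull {p, q, r}"
  have P: "M \<subseteq> ?P" if "M \<in> transversals S {i, j, k, l}" for M
    using transversal_of_adjacent_segments_subset_plane[where S = S and L = M, OF _ _ S(1,2)] assms(3) that
      transversals_mono[of "{i, j}" "{i, j, k, l}" S] by auto
  obtain x where x: "affine L" "aff_dim L = 1" "inj_on x {i, j, k, l}" "x k \<in> L \<inter> S k" "x l \<in> L \<inter> S l"
    using assms(1) by (auto simp: transversals_def)
  obtain x' where x': "affine L'" "aff_dim L' = 1" "x' k \<in> L' \<inter> S k" "x' l \<in> L' \<inter> S l"
    using assms(2) by (auto simp: transversals_def)
  have off: "e \<notin> ?P" if "\<not> coplanar {p, q, r, e}" for e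
    using that coplanar_if_subset_plane[of "{p, q, r, e}" p q r] by (auto simp: hull_inc)
  have inP: "x k \<in> ?P" "x l \<in> ?P" "x' k \<in> ?P" "x' l \<in> ?P"
    using x(4,5) x'(3,4) P[OF assms(1)] P[OF assms(2)] by blast+
  have "x k = x' k"
    using affine_segment_subset[of ?P "x k" "x' k" a b] x(4,5) x'(3,4) S inP off[OF assms(8)] by auto
  moreover have "x l = x' l"
    using affine_segment_subset[of ?P "x l" "x' l" c d] x(4,5) x'(3,4) S inP off[OF assms(9)] by auto
  moreover have "x k \<noteq> x l"
    using x(3) assms(3) by (auto dest: inj_onD)
  ultimately show ?thesis
    using affine_line_eq_hull[of L "x k" "x l"] affine_line_eq_hull[of L' "x k" "x l"] x x' by auto
qed

text \<open>Two distinct lines through \<open>z\<close> lie in one plane, which would contain both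
  skew segments. Hence distinct transversals meet a further segment in distinct points.\<close>

lemma transversals_of_skew_lines_no_common_point:
  fixes L L' :: "(real^3) set"
  assumes "affine L" "aff_dim L = 1" "affine L'" "aff_dim L' = 1" "L \<noteq> L'"
    and "\<not> coplanar {a, b, c, d}"
    and "x \<in> L" "y \<in> L" "z \<in> L" "z \<noteq> x" "z \<noteq> y"
    and "x' \<in> L'" "y' \<in> L'" "z \<in> L'" "z \<noteq> x'" "z \<noteq> y'"
    and M: "x \<in> closed_segment a b" "x' \<in> closed_segment a b"
    and N: "y \<in> closed_segment c d" "y' \<in> closed_segment c d"
  shows False
proof -
  let ?P = "affine hull {x, x', z}"
  have P: "affine ?P" "x \<in> ?P" "x' \<in> ?P" "z \<in> ?P"
    by (simp_all add: hull_inc)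
  \<comment> \<open>A second common point besides \<open>z\<close> would make the lines
    equal.\<close>
  have "x \<noteq> x'" "y \<noteq> y'"
    using affine_line_eq_hull[of L _ z] affine_line_eq_hull[of L' _ z] assms by metis+
  have "L \<subseteq> ?P" "L' \<subseteq> ?P"
    using affine_line_subset[of L x z ?P] affine_line_subset[of L' x' z ?P] P assms by auto
  then have y: "y \<in> ?P" "y' \<in> ?P"
    using assms by auto
  have "a \<in> ?P" "b \<in> ?P"
    using affine_segment_subset[of ?P x x' a b] affine_segment_subset[of ?P x x' b a]
      P M \<open>x \<noteq> x'\<close> by (auto simp: closed_segment_commute)
  moreover have "c \<in> ?P" "d \<in> ?P"
    using affine_segment_subset[of ?P y y' c d] affine_segment_subset[of ?P y y' d c]
      P y N \<open>y \<noteq> y'\<close> by (auto simp: closed_segment_commute)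
  ultimately show False
    using assms(6) coplanar_if_subset_plane[of "{a, b, c, d}" x x' z] by blast
qed

text \<open>Each transversal meets the quadric in three points, so lies on it. The three
  transversals then give three distinct points of segment \<open>l\<close> on the quadric.\<close>

lemma segment_in_generated_quadric:
  fixes a b :: "'i \<Rightarrow> real^3"
  defines "S \<equiv> \<lambda>i. closed_segment (a i) (b i)"
  assumes T: "L\<^sub>1 \<in> transversals S {i, j, k, l}" "L\<^sub>2 \<in> transversals S {i, j, k, l}"
      "L\<^sub>3 \<in> transversals S {i, j, k, l}"
    and "distinct [L\<^sub>1, L\<^sub>2, L\<^sub>3]" and ind: "distinct [i, j, k, l]"
    and skew: "\<not> coplanar {a i, b i, a j, b j}" "\<not> coplanar {a i, b i, a k, b k}" "\<not> coplanar {a j, b j, a k, b k}"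
    and "a l \<noteq> b l"
  shows "S l \<subseteq> generated_quadric (S i) (S j) (S k)"
proof -
  let ?I = "{i, j, k, l}" and ?Q = "generated_quadric (S i) (S j) (S k)"
  have S: "S m = closed_segment (a m) (b m)" for m
    by (simp add: S_def)
  note Q = generated_quadric[OF skew, folded S]
  have seg: "S m \<subseteq> affine hull {a m, b m}" for m
    unfolding S by (intro closed_segment_subset affine_imp_convex affine_affine_hull; simp add: hull_inc)
  have SQ: "S i \<subseteq> ?Q" "S j \<subseteq> ?Q" "S k \<subseteq> ?Q"
    using seg Q(2-4) by blast+
  \<comment> \<open>The points on segments \<open>i\<close> and \<open>j\<close> are kept in order
    to show later that the three feet on segment \<open>l\<close> differ.\<close>
  have foot: "\<exists>x \<in> L \<inter> S l \<inter> ?Q. \<exists>y \<in> L \<inter> S i. \<exists>z \<in> L \<inter> S j. x \<noteq> y \<and> x \<noteq> z"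
    if L: "L \<in> transversals S ?I" for L
  proof -
    obtain x where x: "affine L" "aff_dim L = 1" "inj_on x ?I" "\<And>m. m \<in> ?I \<Longrightarrow> x m \<in> L \<inter> S m"
      using L by (auto simp: transversals_def)
    have ne: "x i \<noteq> x j" "x i \<noteq> x k" "x j \<noteq> x k" "x l \<noteq> x i" "x l \<noteq> x j"
      using inj_onD[OF x(3)] ind by auto
    have "L \<subseteq> ?Q"
      using quadric_contains_line[OF Q(1) x(1,2), of "x i" "x j" "x k"] x(4) ne SQ by auto
    then have "x l \<in> L \<inter> S l \<inter> ?Q" "x i \<in> L \<inter> S i" "x j \<in> L \<inter> S j"
      using x(4)[of l] x(4)[of i] x(4)[of j] by auto
    with ne show ?thesis
      by blast
  qed
  obtain x\<^sub>1 y\<^sub>1 z\<^sub>1 where 1: "x\<^sub>1 \<in> L\<^sub>1 \<inter> S l \<inter> ?Q" "y\<^sub>1 \<in> L\<^sub>1 \<inter> S i" "z\<^sub>1 \<in> L\<^sub>1 \<inter> S j" "x\<^sub>1 \<noteq> y\<^sub>1" "x\<^sub>1 \<noteq> z\<^sub>1"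
    using foot[OF T(1)] by blast
  obtain x\<^sub>2 y\<^sub>2 z\<^sub>2 where 2: "x\<^sub>2 \<in> L\<^sub>2 \<inter> S l \<inter> ?Q" "y\<^sub>2 \<in> L\<^sub>2 \<inter> S i" "z\<^sub>2 \<in> L\<^sub>2 \<inter> S j" "x\<^sub>2 \<noteq> y\<^sub>2" "x\<^sub>2 \<noteq> z\<^sub>2"
    using foot[OF T(2)] by blast
  obtain x\<^sub>3 y\<^sub>3 z\<^sub>3 where 3: "x\<^sub>3 \<in> L\<^sub>3 \<inter> S l \<inter> ?Q" "y\<^sub>3 \<in> L\<^sub>3 \<inter> S i" "z\<^sub>3 \<in> L\<^sub>3 \<inter> S j" "x\<^sub>3 \<noteq> y\<^sub>3" "x\<^sub>3 \<noteq> z\<^sub>3"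
    using foot[OF T(3)] by blast
  have lines: "affine L\<^sub>1" "aff_dim L\<^sub>1 = 1" "affine L\<^sub>2" "aff_dim L\<^sub>2 = 1" "affine L\<^sub>3" "aff_dim L\<^sub>3 = 1"
    using T by (auto simp: transversals_def)
  note no_common = transversals_of_skew_lines_no_common_point[OF _ _ _ _ _ skew(1), folded S]
  have "x\<^sub>1 \<noteq> x\<^sub>2"
    using no_common[of L\<^sub>1 L\<^sub>2 y\<^sub>1 z\<^sub>1 x\<^sub>1 y\<^sub>2 z\<^sub>2] 1 2 lines assms(5) by auto
  moreover have "x\<^sub>1 \<noteq> x\<^sub>3"
    using no_common[of L\<^sub>1 L\<^sub>3 y\<^sub>1 z\<^sub>1 x\<^sub>1 y\<^sub>3 z\<^sub>3] 1 3 lines assms(5) by auto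
  moreover have "x\<^sub>2 \<noteq> x\<^sub>3"
    using no_common[of L\<^sub>2 L\<^sub>3 y\<^sub>2 z\<^sub>2 x\<^sub>2 y\<^sub>3 z\<^sub>3] 2 3 lines assms(5) by auto
  ultimately have "affine hull {a l, b l} \<subseteq> ?Q"
    using quadric_contains_line[OF Q(1), of "affine hull {a l, b l}" x\<^sub>1 x\<^sub>2 x\<^sub>3]
      1 2 3 seg[of l] \<open>a l \<noteq> b l\<close> by auto
  with seg show ?thesis
    by blast
qed

subsection \<open>Polygons in general position\<close>

lemma set_subset_path_image_polygonal_path:
  "length vs \<ge> 2 \<Longrightarrow> set vs \<subseteq> path_image (polygonal_path vs)"
proof (induction vs rule: polygonal_path.induct)
  case (1 a b c vs)
  then show ?case
    by (auto simp: path_image_join pathstart_polygonal_path)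
qed auto

lemma pathfinish_polygonal_path: "vs \<noteq> [] \<Longrightarrow> pathfinish (polygonal_path vs) = last vs"
  by (induction vs rule: polygonal_path.induct) auto

text \<open>The first segment meets the rest of the arc only in \<open>b\<close>, so
  \<open>a\<close> does not recur.\<close>

lemma distinct_if_arc_polygonal_path:
  "length vs \<ge> 2 \<Longrightarrow> arc (polygonal_path vs) \<Longrightarrow> distinct vs"
proof (induction vs rule: polygonal_path.induct)
  case (1 a b c vs)
  let ?g = "polygonal_path (b # c # vs)"
  have *: "arc (linepath a b)" "arc ?g" "path_image (linepath a b) \<inter> path_image ?g \<subseteq> {b}"
    using 1(3) by (auto simp: arc_join_eq pathstart_polygonal_path)
  have "a \<noteq> b"
    using arc_distinct_ends[OF *(1)] by simp
  moreover have "a \<notin> path_image ?g"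
    using *(3) \<open>a \<noteq> b\<close> by auto
  ultimately show ?case
    using 1(1) *(2) set_subset_path_image_polygonal_path[of "b # c # vs"] by auto
qed (auto dest: arc_distinct_ends)

text \<open>Without its first segment the closed curve is an arc from \<open>b\<close> round to
  \<open>a\<close> that visits every vertex.\<close>

lemma distinct_if_polygonal_knot:
  assumes "polygonal_knot vs"
  shows "distinct vs"
proof -
  obtain a b c ws where vs: "vs = a # b # c # ws"
    using assms by (auto simp: polygonal_knot_def numeral_3_eq_3 Suc_le_length_iff)
  let ?g = "polygonal_path (b # c # ws @ [a])"
  have "simple_path (linepath a b +++ ?g)"
    using assms by (simp add: polygonal_knot_def closed_polygon_def vs)
  then have "arc ?g"
    by (auto simp: simple_path_join_loop_eq pathstart_polygonal_path pathfinish_polygonal_path)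
  then show ?thesis
    using distinct_if_arc_polygonal_path[of "b # c # ws @ [a]"] by (auto simp: vs)
qed

lemma card_le_2_if_no_three:
  assumes "\<And>x y z. x \<in> S \<Longrightarrow> y \<in> S \<Longrightarrow> z \<in> S \<Longrightarrow> distinct [x, y, z] \<Longrightarrow> False"
  shows "finite S \<and> card S \<le> 2"
proof (rule ccontr)
  assume "\<not> ?thesis"
  then obtain T where T: "T \<subseteq> S" "card T = 3"
    using obtain_subset_with_card_n[of 3 S] infinite_arbitrarily_large[of S 3]
    by (metis Suc_le_eq not_le numeral_2_eq_2 numeral_3_eq_3)
  then obtain x y z where "T = {x, y, z}" "distinct [x, y, z]"
    by (auto simp: card_3_iff)
  with T(1) assms[of x y z] show False
    by auto
qed

lemma card_le_1_if_unique:
  assumes "\<And>x y. x \<in> S \<Longrightarrow> y \<in> S \<Longrightarrow> x = y"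
  shows "finite S \<and> card S \<le> 1"
proof (cases "S = {}")
  case False
  then obtain x where "S = {x}"
    using assms by blast
  then show ?thesis
    by simp
qed simp

section \<open>Lines crossing four given edges\<close>

locale polygon_in_general_position =
  fixes vs :: "(real^3) list"
  assumes distinct: "distinct vs" and length: "3 \<le> length vs"
    and general_position: "general_position vs"
begin

definition nxt :: "nat \<Rightarrow> nat" where
  "nxt i = Suc i mod length vs"

definition edge :: "nat \<Rightarrow> (real^3) set" where
  "edge i = closed_segment (vs ! i) (vs ! nxt i)"

text \<open>Further intersections with the polygon are allowed, which is harmless for an upper
  bound.\<close>

definition crossings :: "nat set \<Rightarrow> (real^3) set set" where
  "crossings I = {L \<in> transversals edge I. L \<inter> set vs = {}}"

lemma nxt_eq: "i < length vs \<Longrightarrow> nxt i = (if Suc i = length vs then 0 else Suc i)"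
  by (auto simp: nxt_def)

lemma nxt_less: "nxt i < length vs"
  unfolding nxt_def using length by (intro mod_less_divisor) linarith

lemma nxt_0: "nxt 0 = Suc 0"
  using length by (auto simp: nxt_def)

lemma edges_eq: "edges vs = edge ` {..<length vs}"
  by (auto simp: edges_def edge_def nxt_def)

lemma nth_inj: "i < length vs \<Longrightarrow> j < length vs \<Longrightarrow> vs ! i = vs ! j \<longleftrightarrow> i = j"
  using distinct nth_eq_iff_index_eq by blast

text \<open>A segment determines its unordered pair of endpoints, and with at least three vertices
  \<open>i = nxt j\<close> and \<open>j = nxt i\<close> cannot both hold.\<close>

lemma inj_on_edge: "inj_on edge {..<length vs}"
proof (rule inj_onI)
  fix i j assume ij: "i \<in> {..<length vs}" "j \<in> {..<length vs}" "edge i = edge j"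
  then have "{vs ! i, vs ! nxt i} = {vs ! j, vs ! nxt j}"
    by (simp add: edge_def)
  then show "i = j"
    using ij length nxt_less[of i] nxt_less[of j]
    by (auto simp: doubleton_eq_iff nth_inj) (auto simp: nxt_0 nxt_eq split: if_splits)
qed

lemma card_edges: "card (edges vs) = length vs"
  by (simp add: edges_eq card_image inj_on_edge)

lemma not_coplanar:
  assumes "distinct [i, j, k, l]" "{i, j, k, l} \<subseteq> {..<length vs}"
  shows "\<not> coplanar {vs ! i, vs ! j, vs ! k, vs ! l}"
proof -
  have "card {vs ! i, vs ! j, vs ! k, vs ! l} = 4" "{vs ! i, vs ! j, vs ! k, vs ! l} \<subseteq> set vs"
    using assms by (auto simp: nth_inj)
  then show ?thesis
    using general_position by (auto simp: general_position_def)
qed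

lemma skew_edges:
  assumes "distinct [i, nxt i, j, nxt j]" "i < length vs" "j < length vs"
  shows "\<not> coplanar {vs ! i, vs ! nxt i, vs ! j, vs ! nxt j}" "skew (edge i) (edge j)"
proof -
  show 1: "\<not> coplanar {vs ! i, vs ! nxt i, vs ! j, vs ! nxt j}"
    using assms nxt_less by (intro not_coplanar) auto
  have "{vs ! i, vs ! nxt i, vs ! j, vs ! nxt j} \<subseteq> affine hull edge i \<union> affine hull edge j"
    by (auto simp: edge_def hull_inc)
  with 1 show "skew (edge i) (edge j)"
    unfolding skew_def using coplanar_subset by blast
qed

text \<open>With at least four vertices, the endpoints of three consecutive edges are four distinct,
  hence non-coplanar, points.\<close>

lemma crossings_consecutive:
  assumes "{i, nxt i, nxt (nxt i)} \<subseteq> I" "i < length vs" "4 \<le> length vs"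
  shows "crossings I = {}"
proof -
  have "vs ! nxt (nxt i) \<in> L" if "L \<in> transversals edge I" for L
  proof (rule no_transversal_of_consecutive_segments)
    show "L \<in> transversals edge {i, nxt i, nxt (nxt i)}"
      using that transversals_mono[OF assms(1)] by blast
    show "\<not> coplanar {vs ! i, vs ! nxt i, vs ! nxt (nxt i), vs ! nxt (nxt (nxt i))}"
      using assms nxt_less by (intro not_coplanar) (auto simp: nxt_0 nxt_eq split: if_splits)
  qed (use assms in \<open>auto simp: edge_def nxt_eq split: if_splits\<close>)
  then show ?thesis
    using nth_mem[OF nxt_less] unfolding crossings_def by blast
qed

text \<open>The initial vertices of edges \<open>k\<close> and \<open>l\<close> differ from the
  three vertices of the adjacent pair, so they lie off its plane.\<close>

lemma crossings_adjacent:
  assumes "I = {i, nxt i, k, l}" "distinct [i, nxt i, k, l]"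
    and "I \<subseteq> {..<length vs}" "nxt k \<noteq> i" "nxt l \<noteq> i" "k \<noteq> nxt (nxt i)" "l \<noteq> nxt (nxt i)"
  shows "finite (crossings I) \<and> card (crossings I) \<le> 1"
proof (rule card_le_1_if_unique)
  fix L L' assume L: "L \<in> crossings I" "L' \<in> crossings I"
  have i: "i < length vs" "distinct [i, nxt i, nxt (nxt i)]"
    using assms(2,3) length unfolding assms(1) by (auto simp: nxt_0 nxt_eq split: if_splits)
  show "L = L'"
  proof (rule transversal_with_adjacent_segments_unique)
    show "L \<in> transversals edge {i, nxt i, k, l}" "L' \<in> transversals edge {i, nxt i, k, l}"
      using L assms(1) by (auto simp: crossings_def)
    show "\<not> coplanar {vs ! i, vs ! nxt i, vs ! nxt (nxt i), vs ! k}"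
      using assms i nxt_less by (intro not_coplanar) auto
    show "\<not> coplanar {vs ! i, vs ! nxt i, vs ! nxt (nxt i), vs ! l}"
      using assms i nxt_less by (intro not_coplanar) auto
  qed (use assms in \<open>auto simp: edge_def\<close>)
qed

text \<open>Three crossing lines would put edge \<open>l\<close> on the quadric generated by the
  other edges, against general position.\<close>

lemma crossings_skew:
  assumes "I = {i, j, k, l}" "distinct [i, j, k, l]" "I \<subseteq> {..<length vs}"
    and nonadj: "\<And>i j. i \<in> I \<Longrightarrow> j \<in> I \<Longrightarrow> nxt i \<noteq> j"
  shows "finite (crossings I) \<and> card (crossings I) \<le> 2"
proof (rule card_le_2_if_no_three)
  fix L\<^sub>1 L\<^sub>2 L\<^sub>3 assume L: "L\<^sub>1 \<in> crossings I" "L\<^sub>2 \<in> crossings I" "L\<^sub>3 \<in> crossings I" "distinct [L\<^sub>1, L\<^sub>2, L\<^sub>3]"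
  \<comment> \<open>Adjacency is excluded in both directions and \<open>nxt\<close> is injective on
    indices, so all four endpoints differ.\<close>
  have dist: "distinct [i, nxt i, j, nxt j]" if "i \<in> I" "j \<in> I" "i \<noteq> j" for i j
  proof -
    have "i < length vs" "j < length vs"
      using that assms(3) by auto
    then show ?thesis
      using that nonadj[of i i] nonadj[of j j] nonadj[of i j] nonadj[of j i] nxt_eq[of i] nxt_eq[of j]
      by (auto split: if_splits)
  qed
  have skew: "\<not> coplanar {vs ! i, vs ! nxt i, vs ! j, vs ! nxt j}" "skew (edge i) (edge j)"
    if "i \<in> I" "j \<in> I" "i \<noteq> j" for i j
    using skew_edges[OF dist[OF that]] that assms(3) by auto
  have "edge l \<subseteq> generated_quadric (edge i) (edge j) (edge k)"
    unfolding edge_def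
  proof (rule segment_in_generated_quadric)
    show "L\<^sub>1 \<in> transversals (\<lambda>i. closed_segment (vs ! i) (vs ! nxt i)) {i, j, k, l}"
      "L\<^sub>2 \<in> transversals (\<lambda>i. closed_segment (vs ! i) (vs ! nxt i)) {i, j, k, l}"
      "L\<^sub>3 \<in> transversals (\<lambda>i. closed_segment (vs ! i) (vs ! nxt i)) {i, j, k, l}"
      using L assms(1) by (auto simp: crossings_def edge_def[abs_def])
    show "vs ! l \<noteq> vs ! nxt l"
      using nonadj[of l l] assms(1,3) nxt_less by (auto simp: nth_inj)
  qed (use assms(1,2) L(4) skew(1) in auto)
  moreover have "edge l \<in> edges vs - {edge i, edge j, edge k}"
    using assms(1-3) inj_on_edge by (auto simp: edges_eq dest: inj_onD)
  moreover have "edge i \<in> edges vs" "edge j \<in> edges vs" "edge k \<in> edges vs"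
    using assms(1,3) by (auto simp: edges_eq)
  moreover have "skew (edge i) (edge j)" "skew (edge i) (edge k)" "skew (edge j) (edge k)"
    using assms(1,2) by (auto intro!: skew(2))
  ultimately show False
    using general_position unfolding general_position_def by blast
qed

text \<open>The summands stand for the opposite gap pairs \<open>a\<close>-\<open>b\<close>,
  \<open>c\<close>-\<open>d\<close> and \<open>b\<close>-\<open>c\<close>,
  \<open>d\<close>-\<open>a\<close>; the last gap wraps around. Adjacencies in both pairs give three
  consecutive edges; in exactly one pair, an adjacent pair isolated from the other two edges; in
  none, skew edges.\<close>

lemma card_crossings:
  assumes "a < b" "b < c" "c < d" "d < length vs"
  shows "finite (crossings {a, b, c, d}) \<and> card (crossings {a, b, c, d}) \<le>
    of_bool (b \<noteq> Suc a \<and> d \<noteq> Suc c) + of_bool (c \<noteq> Suc b \<and> \<not> (a = 0 \<and> Suc d = length vs))"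
    (is "?finite \<and> _ \<le> of_bool ?P + of_bool ?Q")
proof -
  let ?n = "length vs" and ?I = "{a, b, c, d}"
  note nxt = assms nxt_0 nxt_eq[of a] nxt_eq[of b] nxt_eq[of c] nxt_eq[of d]
  have sub: "?I \<subseteq> {..<?n}"
    using assms by auto
  have consecutive: "finite (crossings ?I) \<and> card (crossings ?I) \<le> 0"
    if "i \<in> ?I" "nxt i \<in> ?I" "nxt (nxt i) \<in> ?I" for i
    using crossings_consecutive[of i ?I] that sub assms by auto
  have adjacent: "finite (crossings ?I) \<and> card (crossings ?I) \<le> 1"
    if "?I = {i, nxt i, k, l}" "distinct [i, nxt i, k, l]" "nxt k \<noteq> i" "nxt l \<noteq> i"
      "k \<noteq> nxt (nxt i)" "l \<noteq> nxt (nxt i)" for i k l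
    using crossings_adjacent[OF that(1,2) sub] that by blast
  consider (none) "\<not> ?P" "\<not> ?Q" | (one) "\<not> ?P \<longleftrightarrow> ?Q" | (two) ?P ?Q
    by blast
  then show ?thesis
  proof cases
    case none
    then consider "b = Suc a" "c = Suc b" | "b = Suc a" "a = 0" "Suc d = ?n"
      | "d = Suc c" "c = Suc b" | "d = Suc c" "a = 0" "Suc d = ?n"
      by blast
    then have "finite (crossings ?I) \<and> card (crossings ?I) \<le> 0"
    proof cases
      case 1
      show ?thesis
        by (rule consecutive[of a]) (use 1 nxt in \<open>auto split: if_splits\<close>)
    next
      case 2
      show ?thesis
        by (rule consecutive[of d]) (use 2 nxt in \<open>auto split: if_splits\<close>)
    next
      case 3
      have "nxt b = c" "nxt c = d"
        using 3 assms nxt_eq[of b] nxt_eq[of c] by auto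
      then show ?thesis
        by (intro consecutive[of b]) auto
    next
      case 4
      show ?thesis
        by (rule consecutive[of c]) (use 4 nxt in \<open>auto split: if_splits\<close>)
    qed
    then show ?thesis
      by auto
  next
    case one
    then consider "b = Suc a" ?Q | "d = Suc c" ?Q | "c = Suc b" ?P | "a = 0" "Suc d = ?n" ?P
      by blast
    then have "finite (crossings ?I) \<and> card (crossings ?I) \<le> 1"
    proof cases
      case 1
      show ?thesis
        by (rule adjacent[of a c d]) (use 1 nxt in \<open>auto split: if_splits\<close>)
    next
      case 2
      show ?thesis
        by (rule adjacent[of c a b]) (use 2 nxt in \<open>auto split: if_splits\<close>)
    next
      case 3
      show ?thesis
        by (rule adjacent[of b a d]) (use 3 nxt in \<open>auto split: if_splits\<close>)
    next
      case 4
      show ?thesis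
        by (rule adjacent[of d b c]) (use 4 nxt in \<open>auto split: if_splits\<close>)
    qed
    with one show ?thesis
      by auto
  next
    case two
    have "finite (crossings ?I) \<and> card (crossings ?I) \<le> 2"
    proof (rule crossings_skew[OF refl _ sub])
      show "nxt i \<noteq> j" if "i \<in> ?I" "j \<in> ?I" for i j
        using that two nxt by (auto split: if_splits)
    qed (use assms in auto)
    with two show ?thesis
      by auto
  qed
qed

text \<open>Two common points would put the vertex \<open>vs ! i\<close> on
  \<open>L\<close>.\<close>

lemma edge_inter_line:
  assumes "affine L" "aff_dim L = 1" "L \<inter> set vs = {}" "i < length vs"
    and "x \<in> L \<inter> edge i" "y \<in> L \<inter> edge i"
  shows "x = y"
  using affine_segment_subset[of L x y "vs ! i" "vs ! nxt i"] assms nth_mem[of i vs]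
  unfolding edge_def by blast

text \<open>Choose an edge for each of the four points. The choice is injective because the line
  meets each edge at most once.\<close>

lemma generic_quadrisecant_crossing:
  assumes "generic_quadrisecant vs L"
  shows "\<exists>I. I \<subseteq> {..<length vs} \<and> card I = 4 \<and> L \<in> crossings I"
proof -
  have "vs \<noteq> []"
    using length by auto
  then have L: "affine L" "aff_dim L = 1" "L \<inter> set vs = {}" "card (L \<inter> (\<Union>i<length vs. edge i)) = 4"
    using assms path_image_closed_polygon[of vs]
    by (auto simp: generic_quadrisecant_def edges_eq)
  let ?X = "L \<inter> (\<Union>i<length vs. edge i)"
  obtain f where f: "\<And>x. x \<in> ?X \<Longrightarrow> f x < length vs \<and> x \<in> edge (f x)"
    by (metis (no_types, lifting) IntE UN_E lessThan_iff)
  have inj: "inj_on f ?X"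
  proof (rule inj_onI)
    fix x y assume xy: "x \<in> ?X" "y \<in> ?X" "f x = f y"
    show "x = y"
      by (rule edge_inter_line[OF L(1-3), of "f x"]) (use xy f[of x] f[of y] in auto)
  qed
  show ?thesis
  proof (intro exI conjI)
    show "f ` ?X \<subseteq> {..<length vs}"
      using f by blast
    show "card (f ` ?X) = 4"
      using card_image[OF inj] L(4) by simp
    \<comment> \<open>Inverting the choice of edges yields the distinct points required by
      \<open>transversals\<close>.\<close>
    have "inj_on (inv_into ?X f) (f ` ?X)"
      by (simp add: inj_on_inv_into)
    moreover have "inv_into ?X f i \<in> L \<inter> edge i" if "i \<in> f ` ?X" for i
      using inv_into_into[OF that] f_inv_into_f[OF that] f[of "inv_into ?X f i"] by auto
    ultimately show "L \<in> crossings (f ` ?X)"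
      using L unfolding crossings_def transversals_def by blast
  qed
qed

end

subsection \<open>Counting\<close>

definition increasing_quadruples :: "nat \<Rightarrow> (nat \<times> nat \<times> nat \<times> nat) set" where
  "increasing_quadruples m = {(a, b, c, d). a < b \<and> b < c \<and> c < d \<and> d < m}"

lemma finite_increasing_quadruples: "finite (increasing_quadruples m)"
  by (rule finite_subset[of _ "{..<m} \<times> {..<m} \<times> {..<m} \<times> {..<m}"])
    (auto simp: increasing_quadruples_def)

lemma card_Un_inj_image:
  assumes "finite A" "finite B" "inj_on f B" "A \<inter> f ` B = {}"
  shows "card (A \<union> f ` B) = card A + card B"
  using assms by (simp add: card_Un_disjoint card_image)

text \<open>A binomial coefficient, multiplied out to avoid division. The induction step adds the
  tuples with largest entry \<open>m\<close>, as it does for triples and quadruples below.\<close>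

lemma card_increasing_pairs: "2 * card {(a, b). a < b \<and> b < (m::nat)} = m * (m - 1)"
proof (induction m)
  case (Suc m)
  have "{(a, b). a < b \<and> b < Suc m} = {(a, b). a < b \<and> b < m} \<union> (\<lambda>a. (a, m)) ` {..<m}"
    by auto
  moreover have "finite {(a, b). a < b \<and> b < m}"
    by (rule finite_subset[of _ "{..<m} \<times> {..<m}"]) auto
  then have "card ({(a, b). a < b \<and> b < m} \<union> (\<lambda>a. (a, m)) ` {..<m}) = card {(a, b). a < b \<and> b < m} + m"
    by (subst card_Un_inj_image) (auto simp: inj_on_def)
  ultimately have "card {(a, b). a < b \<and> b < Suc m} = card {(a, b). a < b \<and> b < m} + m"
    by simp
  with Suc show ?case
    by (cases m) auto
qed simp

lemma card_increasing_triples: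
  "6 * card {(a, b, c). a < b \<and> b < c \<and> c < (m::nat)} = m * (m - 1) * (m - 2)"
proof (induction m)
  case (Suc m)
  let ?T = "{(a, b, c). a < b \<and> b < c \<and> c < m}" and ?P = "{(a, b). a < b \<and> b < m}"
  have "{(a, b, c). a < b \<and> b < c \<and> c < Suc m} = ?T \<union> (\<lambda>(a, b). (a, b, m)) ` ?P"
    by (auto simp: image_iff)
  moreover have "finite ?T" "finite ?P"
    by (rule finite_subset[of _ "{..<m} \<times> {..<m} \<times> {..<m}"], auto)
      (rule finite_subset[of _ "{..<m} \<times> {..<m}"], auto)
  then have "card (?T \<union> (\<lambda>(a, b). (a, b, m)) ` ?P) = card ?T + card ?P"
    by (rule card_Un_inj_image) (auto simp: inj_on_def)
  ultimately have "card {(a, b, c). a < b \<and> b < c \<and> c < Suc m} = card ?T + card ?P"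
    by simp
  then have "6 * card {(a, b, c). a < b \<and> b < c \<and> c < Suc m} = m * (m - 1) * (m - 2) + 3 * (m * (m - 1))"
    using Suc card_increasing_pairs[of m] by linarith
  then show ?case
    by (cases m rule: nat.exhaust[case_names 0 Suc], simp, cases "m - 1") (auto simp: algebra_simps)
qed simp

lemma card_increasing_quadruples:
  "24 * card (increasing_quadruples m) = m * (m - 1) * (m - 2) * (m - 3)"
proof (induction m)
  case 0
  then show ?case
    using finite_increasing_quadruples[of 0] by (simp add: increasing_quadruples_def case_prod_unfold)
next
  case (Suc m)
  let ?T = "{(a, b, c). a < b \<and> b < c \<and> c < m}"
  have "increasing_quadruples (Suc m) = increasing_quadruples m \<union> (\<lambda>(a, b, c). (a, b, c, m)) ` ?T"
    by (auto simp: increasing_quadruples_def image_iff)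
  moreover have "finite ?T"
    by (rule finite_subset[of _ "{..<m} \<times> {..<m} \<times> {..<m}"]) auto
  then have "card (increasing_quadruples m \<union> (\<lambda>(a, b, c). (a, b, c, m)) ` ?T) =
      card (increasing_quadruples m) + card ?T"
    by (rule card_Un_inj_image[OF finite_increasing_quadruples])
      (auto simp: inj_on_def increasing_quadruples_def)
  ultimately have "card (increasing_quadruples (Suc m)) = card (increasing_quadruples m) + card ?T"
    by simp
  then have *: "24 * card (increasing_quadruples (Suc m)) =
      m * (m - 1) * (m - 2) * (m - 3) + 4 * (m * (m - 1) * (m - 2))"
    using Suc card_increasing_triples[of m] by linarith
  \<comment> \<open>Small \<open>m\<close> is separate because subtraction of naturals
    truncates.\<close>
  show ?case
  proof (cases "m < 3")
    case True
    then have "m = 0 \<or> m = 1 \<or> m = 2"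
      by auto
    with * show ?thesis
      by auto
  next
    case False
    then obtain k where "m = k + 3"
      by (metis add.commute le_Suc_ex not_le)
    with * show ?thesis
      by (simp add: algebra_simps)
  qed
qed

text \<open>The four cyclic gaps of a quadruple form two opposite pairs; its weight is the number of
  pairs without a gap of length 1. Shrinking the gaps of such a pair reduces the count to all
  quadruples of a smaller set.\<close>

lemma sum_gap_weights:
  "12 * (\<Sum>(a, b, c, d) \<in> increasing_quadruples (m + 3).
     of_bool (b \<noteq> Suc a \<and> d \<noteq> Suc c) + of_bool (c \<noteq> Suc b \<and> \<not> (a = 0 \<and> Suc d = m + 3)))
   = (m + 3) * m * (m - 1) * (m - 2)"
proof -
  let ?I = "increasing_quadruples (m + 3)"
  let ?P = "{q \<in> ?I. case q of (a, b, c, d) \<Rightarrow> b \<noteq> Suc a \<and> d \<noteq> Suc c}"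
  let ?Q = "{q \<in> ?I. case q of (a, b, c, d) \<Rightarrow> c \<noteq> Suc b \<and> \<not> (a = 0 \<and> Suc d = m + 3)}"
  \<comment> \<open>\<open>?Q\<close> is counted as \<open>?R\<close> without \<open>?E\<close>:
    first ignore the wrap-around gap, then discard the quadruples where it is an adjacency.\<close>
  let ?R = "{q \<in> ?I. case q of (a, b, c, d) \<Rightarrow> c \<noteq> Suc b}"
  let ?E = "{q \<in> ?I. case q of (a, b, c, d) \<Rightarrow> c \<noteq> Suc b \<and> a = 0 \<and> Suc d = m + 3}"
  note fin = finite_increasing_quadruples[of "m + 3"]
  have sum: "(\<Sum>(a, b, c, d) \<in> ?I. of_bool (b \<noteq> Suc a \<and> d \<noteq> Suc c) + of_bool (c \<noteq> Suc b \<and> \<not> (a = 0 \<and> Suc d = m + 3)))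
    = card ?P + card ?Q"
    using fin by (simp add: case_prod_unfold sum.distrib sum_of_bool_eq Int_def)
  \<comment> \<open>Both gaps shrink by one, so \<open>d\<close> drops by 2 and the bound becomes
    \<open>m + 1\<close>.\<close>
  have P: "card ?P = card (increasing_quadruples (m + 1))"
    by (rule bij_betw_same_card[OF bij_betw_byWitness[where f = "\<lambda>(a, b, c, d). (a, b - 1, c - 1, d - 2)"
        and f' = "\<lambda>(a, b, c, d). (a, b + 1, c + 1, d + 2)"]])
      (auto simp: increasing_quadruples_def)
  have R: "card ?R = card (increasing_quadruples (m + 2))"
    by (rule bij_betw_same_card[OF bij_betw_byWitness[where f = "\<lambda>(a, b, c, d). (a, b, c - 1, d - 1)"
        and f' = "\<lambda>(a, b, c, d). (a, b, c + 1, d + 1)"]])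
      (auto simp: increasing_quadruples_def)
  \<comment> \<open>Here \<open>a = 0\<close> and \<open>d = m + 2\<close> are fixed; shifting
    \<open>b\<close> and shrinking the gap to \<open>c\<close> leaves all increasing pairs below
    \<open>m\<close>.\<close>
  have E: "card ?E = card {(b, c). b < c \<and> c < m}"
    by (rule bij_betw_same_card[OF bij_betw_byWitness[where f = "\<lambda>(a, b, c, d). (b - 1, c - 2)"
        and f' = "\<lambda>(b, c). (0, b + 1, c + 2, m + 2)"]])
      (auto simp: increasing_quadruples_def)
  have "?R = ?Q \<union> ?E"
    by auto
  moreover have "card (?Q \<union> ?E) = card ?Q + card ?E"
    using fin by (intro card_Un_disjoint) auto
  ultimately have Q: "card ?R = card ?Q + card ?E"
    by simp
  have 1: "24 * card ?P = (m + 1) * m * (m - 1) * (m - 2)"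
    using card_increasing_quadruples[of "m + 1"] unfolding P by simp
  have 2: "24 * (card ?Q + card ?E) = (m + 2) * (m + 1) * m * (m - 1)"
    using card_increasing_quadruples[of "m + 2"] unfolding Q[symmetric] R by simp
  have 3: "2 * card ?E = m * (m - 1)"
    using card_increasing_pairs[of m] unfolding E .
  \<comment> \<open>Adding the count of \<open>?E\<close> on the left avoids subtraction of
    naturals.\<close>
  have "24 * (card ?P + card ?Q) + 12 * (2 * card ?E) = 24 * card ?P + 24 * (card ?Q + card ?E)"
    by simp
  then have "24 * (card ?P + card ?Q) + 12 * (m * (m - 1)) = (m + 1) * m * (m - 1) * (m - 2) + (m + 2) * (m + 1) * m * (m - 1)"
    unfolding 1 2 3 .
  moreover have "(m + 1) * m * (m - 1) * (m - 2) + (m + 2) * (m + 1) * m * (m - 1) =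
      2 * ((m + 3) * m * (m - 1) * (m - 2)) + 12 * (m * (m - 1))"
  proof (cases "m < 2")
    case True
    then have "m = 0 \<or> m = 1"
      by auto
    then show ?thesis
      by auto
  next
    case False
    then obtain k where "m = k + 2"
      by (metis add.commute le_Suc_ex not_le)
    then show ?thesis
      by (simp add: algebra_simps)
  qed
  ultimately show ?thesis
    unfolding sum by linarith
qed

lemma increasing_quadruple_of_card_4:
  assumes "I \<subseteq> {..<m}" "card I = 4"
  shows "\<exists>(a, b, c, d) \<in> increasing_quadruples m. I = {a, b, c, d}"
proof -
  have "finite I"
    using assms(1) finite_subset by blast
  define xs where "xs = sorted_list_of_set I"
  have xs: "sorted_wrt (<) xs" "set xs = I" "length xs = 4"
    using \<open>finite I\<close> assms(2) by (auto simp: xs_def)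
  then obtain a b c d where "xs = [a, b, c, d]"
    by (auto simp: numeral_eq_Suc length_Suc_conv)
  with xs assms(1) show ?thesis
    by (intro bexI[of _ "(a, b, c, d)"]) (auto simp: increasing_quadruples_def)
qed

section \<open>Summation over all quadruples of edges\<close>

context polygon_in_general_position
begin

lemma card_generic_quadrisecants:
  "finite {L. generic_quadrisecant vs L}"
  "12 * card {L. generic_quadrisecant vs L} \<le>
    length vs * (length vs - 3) * (length vs - 4) * (length vs - 5)"
proof -
  let ?n = "length vs"
  define C where "C = (\<lambda>(a, b, c, d). crossings {a, b, c, d})"
  let ?w = "\<lambda>(a, b, c, d). of_bool (b \<noteq> Suc a \<and> d \<noteq> Suc c) + of_bool (c \<noteq> Suc b \<and> \<not> (a = 0 \<and> Suc d = ?n))"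
  let ?I = "increasing_quadruples ?n"
  have C: "finite (C q) \<and> card (C q) \<le> ?w q" if "q \<in> ?I" for q
    using that card_crossings unfolding C_def increasing_quadruples_def by fastforce
  have sub: "{L. generic_quadrisecant vs L} \<subseteq> (\<Union>q\<in>?I. C q)"
  proof
    fix L assume "L \<in> {L. generic_quadrisecant vs L}"
    then obtain I where "I \<subseteq> {..<?n}" "card I = 4" "L \<in> crossings I"
      using generic_quadrisecant_crossing by blast
    moreover from this(1,2) obtain q where "q \<in> ?I" "case q of (a, b, c, d) \<Rightarrow> I = {a, b, c, d}"
      using increasing_quadruple_of_card_4 by blast
    ultimately show "L \<in> (\<Union>q\<in>?I. C q)"
      by (auto simp: C_def)
  qed
  have fin: "finite (\<Union>q\<in>?I. C q)"
    using C finite_increasing_quadruples by blast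
  with sub show "finite {L. generic_quadrisecant vs L}"
    using finite_subset by blast
  have "card {L. generic_quadrisecant vs L} \<le> card (\<Union>q\<in>?I. C q)"
    using card_mono[OF fin sub] .
  also have "\<dots> \<le> (\<Sum>q\<in>?I. card (C q))"
    by (rule card_UN_le[OF finite_increasing_quadruples])
  also have "\<dots> \<le> (\<Sum>q\<in>?I. ?w q)"
    using C by (intro sum_mono) blast
  finally have le: "card {L. generic_quadrisecant vs L} \<le> (\<Sum>q\<in>?I. ?w q)" .
  \<comment> \<open>With \<open>m = n - 3\<close> the product of the weight sum becomes the required
    one.\<close>
  obtain m where "?n = m + 3"
    using length by (metis add.commute le_Suc_ex)
  with le sum_gap_weights[of m] show "12 * card {L. generic_quadrisecant vs L} \<le> ?n * (?n - 3) * (?n - 4) * (?n - 5)"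
    by simp
qed

end

text \<open>Finiteness is asserted as well, since an infinite set has \<open>card\<close> 0 and
  would satisfy the inequality trivially.\<close>

theorem theorem1:
  fixes vs :: "(real^3) list" and n :: nat
  assumes "polygonal_knot vs"
    and "general_position vs"
    and "card (edges vs) = n"
  shows "finite {L. generic_quadrisecant vs L} \<and>
    real (card {L. generic_quadrisecant vs L})
      \<le> real n / 12 * (real n - 3) * (real n - 4) * (real n - 5)"
proof -
  interpret polygon_in_general_position vs
    using assms(1,2) distinct_if_polygonal_knot[OF assms(1)]
    by (simp add: polygonal_knot_def polygon_in_general_position_def)
  have n: "length vs = n" "3 \<le> n"
    using assms(3) card_edges length by simp_all
  have "12 * real (card {L. generic_quadrisecant vs L}) \<le> real (n * (n - 3) * (n - 4) * (n - 5))"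
    using card_generic_quadrisecants(2) unfolding n(1) by (metis of_nat_le_iff of_nat_mult of_nat_numeral)
  also have "\<dots> = real n * (real n - 3) * (real n - 4) * (real n - 5)"
  \<comment> \<open>Truncated and real subtraction differ for \<open>n\<close> equal to 3 or 4, but
    both products are 0 there.\<close>
  proof (cases "n < 5")
    case True
    with n(2) have "n = 3 \<or> n = 4"
      by auto
    then show ?thesis
      by auto
  next
    case False
    then show ?thesis
      by simp
  qed
  finally show ?thesis
    using card_generic_quadrisecants(1) by simp
qed

end
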